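(* Let $d>1$ and let $\Pi^d_{\chi',2d}$ be the proper edge $2d$-coloring problem on $\mathbb{Z}^d$ (color the edges of the grid $\mathbb{Z}^d$ with $2d$ colors so that any two edges sharing a vertex have different colors). Then $\Pi^d_{\chi',2d}$ is in the class $\mathsf{TOAST}$.
   Context: $\mathbb{Z}^d$ denotes the infinite grid: the Cayley graph of the group $\mathbb{Z}^d$ with respect to the standard generators, each edge being oriented and labelled by its generator (isomorphisms preserve this structure); $d(\cdot,\cdot)$ is graph distance. A locally checkable problem (LCL) without inputs on $\mathbb{Z}^d$ consists of a finite set $\Sigma_{out}$, $t\in\mathbb N$, and a set $\mathcal P$ of (isomorphism types of) rooted grids of radius $t$ with vertices labelled by $\Sigma_{out}$; a labelling of $\mathbb{Z}^d$ is a $\Pi$-coloring if the $t$-hop neighborhood of every vertex is in $\mathcal P$. Edge colorings are regarded as LCLs by letting each vertex output the colors of its $2d$ incident edges, with the constraint that adjacent vertices agree on the color of their common edge. For $q>0$, a $q$-toast on $\mathbb{Z}^d$ is a collection $\mathcal D$ of finite connected subsets (pieces) of $\mathbb{Z}^d$ such that (i) for all $g,h\in\mathbb{Z}^d$ there is $D\in\mathcal D$ with $g,h\in D$, and (ii) if $D,E\in\mathcal D$ and $d(\partial D,\partial E)\le q$ then $D=E$, where $\partial D$ is the boundary of $D$ (vertices of $D$ with a neighbor outside $D$). A spontaneous $\mathsf{TOAST}$ algorithm is a function $\mathcal A$ defined on pairs $(A,c)$, with $A$ a finite connected subset of $\mathbb{Z}^d$ and $c$ a partial map from $A$ to $\Sigma_{out}$,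 such that $\mathcal A(A,c)$ is a map from all of $A$ to $\Sigma_{out}$ extending $c$ and depending only on the isomorphism type of $(A,c)$ (not on its position in $\mathbb{Z}^d$). Given a $q$-toast $\mathcal D$, one defines inductively along inclusion $\mathcal A(D)=\mathcal A\big(D,\bigcup\{\mathcal A(E):E\subsetneq D,\ E\in\mathcal D\}\big)$ for $D\in\mathcal D$ (with the empty partial map if there is no such $E$), and $\mathcal A(\mathcal D)=\bigcup_{D\in\mathcal D}\mathcal A(D)$. $\Pi$ is in the class $\mathsf{TOAST}$ if there are $q\in\mathbb N$, $q>0$, and a spontaneous $\mathsf{TOAST}$ algorithm $\mathcal A$ such that $\mathcal A(\mathcal D)$ is a $\Pi$-coloring for every $q$-toast $\mathcal D$.
   Formalization: Only q-toasts whose pieces are pairwise nested or disjoint are considered; conditions (i) and (ii) do not imply this when pieces have holes (a ball and an overlapping annulus), and without it the unions of partial maps defining A(D) need not be maps. *)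

theory Defs
  imports "HOL-Analysis.Finite_Cartesian_Product"
begin

section \<open>The grid\<close>

text \<open>
  The vertices of the grid are the elements of \<^typ>\<open>int ^ 'd\<close>, and \<^typ>\<open>'d\<close> indexes the standard
  generators.  The edge labelled \<open>i\<close> goes from \<open>v\<close> to \<open>v + gen i\<close>.
\<close>

abbreviation gen :: "'d::finite \<Rightarrow> int ^ 'd" where
  "gen i \<equiv> axis i 1"

definition adj :: "int ^ 'd::finite \<Rightarrow> int ^ 'd \<Rightarrow> bool" where
  "adj u v \<longleftrightarrow> (\<exists>i. v = u + gen i \<or> u = v + gen i)"

definition gdist :: "int ^ 'd::finite \<Rightarrow> int ^ 'd \<Rightarrow> nat" where
  "gdist u v = (LEAST n. (adj ^^ n) u v)"

definition hop_ball :: "int ^ 'd::finite \<Rightarrow> nat \<Rightarrow> (int ^ 'd) set" where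
  "hop_ball v t = {u. gdist v u \<le> t}"

definition grid_connected :: "(int ^ 'd::finite) set \<Rightarrow> bool" where
  "grid_connected S \<longleftrightarrow> (\<forall>x\<in>S. \<forall>y\<in>S. (\<lambda>u v. u \<in> S \<and> v \<in> S \<and> adj u v)\<^sup>*\<^sup>* x y)"

definition bdry :: "(int ^ 'd::finite) set \<Rightarrow> (int ^ 'd) set" where
  "bdry D = {v \<in> D. \<exists>u. adj v u \<and> u \<notin> D}"

text \<open>
  Isomorphisms of induced subgraphs preserve the orientation and the generator label of every edge.
\<close>

definition grid_iso ::
  "(int ^ 'd::finite \<Rightarrow> int ^ 'd) \<Rightarrow> (int ^ 'd) set \<Rightarrow> (int ^ 'd) set \<Rightarrow> bool" where
  "grid_iso \<phi> S T \<longleftrightarrow> bij_betw \<phi> S T \<and>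
     (\<forall>u\<in>S. \<forall>v\<in>S. \<forall>i. v = u + gen i \<longleftrightarrow> \<phi> v = \<phi> u + gen i)"


section \<open>Locally checkable problems\<close>

text \<open>
  A rooted labelled grid is a pair \<open>(r, l)\<close> of a root and a partial map whose domain is the vertex
  set.  A set of isomorphism types is represented by an isomorphism-closed set of such pairs.
\<close>

record ('d, 'o) lcl =
  outputs :: "'o set"
  radius :: nat
  allowed :: "((int, 'd::finite) vec \<times> ((int, 'd) vec \<rightharpoonup> 'o)) set"

definition is_lcl :: "('d::finite, 'o) lcl \<Rightarrow> bool" where
  "is_lcl P \<longleftrightarrow> finite (outputs P) \<and>
     (\<forall>(r, l) \<in> allowed P. dom l = hop_ball r (radius P) \<and> ran l \<subseteq> outputs P) \<and>
     (\<forall>(r, l) \<in> allowed P. \<forall>\<phi> l'. grid_iso \<phi> (dom l) (dom l') \<and> (\<forall>u \<in> dom l. l' (\<phi> u) = l u)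
        \<longrightarrow> (\<phi> r, l') \<in> allowed P)"

definition is_coloring :: "('d::finite, 'o) lcl \<Rightarrow> (int ^ 'd \<rightharpoonup> 'o) \<Rightarrow> bool" where
  "is_coloring P f \<longleftrightarrow> dom f = UNIV \<and> ran f \<subseteq> outputs P \<and>
     (\<forall>v. (v, f |` hop_ball v (radius P)) \<in> allowed P)"


section \<open>Toasts and the class TOAST\<close>

definition toast :: "nat \<Rightarrow> (int ^ 'd::finite) set set \<Rightarrow> bool" where
  "toast q \<D> \<longleftrightarrow>
     (\<forall>D\<in>\<D>. finite D \<and> grid_connected D) \<and>
     (\<forall>g h. \<exists>D\<in>\<D>. g \<in> D \<and> h \<in> D) \<and>
     (\<forall>D\<in>\<D>. \<forall>E\<in>\<D>. (\<exists>x\<in>bdry D. \<exists>y\<in>bdry E. gdist x y \<le> q) \<longrightarrow> D = E)"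

text \<open>
  Any two pieces of a toast are understood to be nested or disjoint.  This is what makes the unions
  of partial maps below well defined, and it does not follow from the condition on boundaries when
  pieces have holes: a ball \<open>E\<close> of radius \<open>2 n\<close> and an annulus \<open>D\<close> of radii \<open>n\<close> and \<open>3 n\<close> about the
  same centre overlap with neither containing the other, although their boundaries are far apart.
\<close>

definition nested_or_disjoint :: "'a set set \<Rightarrow> bool" where
  "nested_or_disjoint \<D> \<longleftrightarrow> (\<forall>D\<in>\<D>. \<forall>E\<in>\<D>. D \<subseteq> E \<or> E \<subseteq> D \<or> D \<inter> E = {})"

text \<open>
  The union of the partial maps \<open>F i\<close>, \<open>i \<in> I\<close>.  It is meaningful only if these agree on common
  points; otherwise its value at a point of disagreement is unspecified.
\<close>

definition map_union :: "'i set \<Rightarrow> ('i \<Rightarrow> 'a \<rightharpoonup> 'b) \<Rightarrow> 'a \<rightharpoonup> 'b" where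
  "map_union I F = (\<lambda>x. if \<exists>i\<in>I. x \<in> dom (F i) then Some (THE y. \<exists>i\<in>I. F i x = Some y) else None)"

lemma map_union_cong [fundef_cong]:
  "I = J \<Longrightarrow> (\<And>i. i \<in> J \<Longrightarrow> F i = G i) \<Longrightarrow> map_union I F = map_union J G"
  by (simp add: map_union_def cong: bex_cong if_cong)

type_synonym ('d, 'o) toast_alg =
  "(int, 'd) vec set \<Rightarrow> ((int, 'd) vec \<rightharpoonup> 'o) \<Rightarrow> (int, 'd) vec \<rightharpoonup> 'o"

definition toast_input :: "'o set \<Rightarrow> (int ^ 'd::finite) set \<Rightarrow> (int ^ 'd \<rightharpoonup> 'o) \<Rightarrow> bool" where
  "toast_input \<Sigma> S c \<longleftrightarrow> finite S \<and> grid_connected S \<and> dom c \<subseteq> S \<and> ran c \<subseteq> \<Sigma>"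

definition spontaneous_toast_alg :: "'o set \<Rightarrow> ('d::finite, 'o) toast_alg \<Rightarrow> bool" where
  "spontaneous_toast_alg \<Sigma> \<A> \<longleftrightarrow>
     (\<forall>S c. toast_input \<Sigma> S c \<longrightarrow> dom (\<A> S c) = S \<and> ran (\<A> S c) \<subseteq> \<Sigma> \<and> c \<subseteq>\<^sub>m \<A> S c) \<and>
     (\<forall>S c S' c' \<phi>. toast_input \<Sigma> S c \<and> toast_input \<Sigma> S' c' \<and>
        grid_iso \<phi> S S' \<and> (\<forall>u\<in>S. c' (\<phi> u) = c u) \<longrightarrow> (\<forall>u\<in>S. \<A> S' c' (\<phi> u) = \<A> S c u))"

text \<open>The finiteness test only ensures termination; pieces of a toast are finite.\<close>

function run_piece ::
  "('d::finite, 'o) toast_alg \<Rightarrow> (int ^ 'd) set set \<Rightarrow> (int ^ 'd) set \<Rightarrow> int ^ 'd \<rightharpoonup> 'o" where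
  "run_piece \<A> \<D> D =
     (if finite D then \<A> D (map_union {E \<in> \<D>. E \<subset> D} (\<lambda>E. run_piece \<A> \<D> E)) else Map.empty)"
  by pat_completeness auto
termination
  by (relation "measure (\<lambda>(\<A>, \<D>, D). card D)") (auto intro: psubset_card_mono)

declare run_piece.simps [simp del]

definition run_toast :: "('d::finite, 'o) toast_alg \<Rightarrow> (int ^ 'd) set set \<Rightarrow> int ^ 'd \<rightharpoonup> 'o" where
  "run_toast \<A> \<D> = map_union \<D> (run_piece \<A> \<D>)"

definition in_TOAST :: "('d::finite, 'o) lcl \<Rightarrow> bool" where
  "in_TOAST P \<longleftrightarrow> is_lcl P \<and>
     (\<exists>q>0. \<exists>\<A>. spontaneous_toast_alg (outputs P) \<A> \<and>
        (\<forall>\<D>. toast q \<D> \<and> nested_or_disjoint \<D> \<longrightarrow> is_coloring P (run_toast \<A> \<D>)))"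


section \<open>Proper edge colorings\<close>

text \<open>
  The output of a vertex \<open>v\<close> gives the colors of its incident edges: the value at \<open>(i, True)\<close> is the
  color of the edge between \<open>v\<close> and \<open>v + gen i\<close>, and the value at \<open>(i, False)\<close> is the color of the
  edge between \<open>v - gen i\<close> and \<open>v\<close>.
\<close>

definition edge_outputs :: "nat \<Rightarrow> ('d \<times> bool \<Rightarrow> nat) set" where
  "edge_outputs k = {c. range c \<subseteq> {..<k}}"

definition proper_edge_coloring_lcl :: "nat \<Rightarrow> ('d::finite, 'd \<times> bool \<Rightarrow> nat) lcl" where
  "proper_edge_coloring_lcl k =
     \<lparr>outputs = edge_outputs k,
      radius = 1,
      allowed = {(r, l). dom l = hop_ball r 1 \<and> ran l \<subseteq> edge_outputs k \<and>
        inj (the (l r)) \<and>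
        (\<forall>i. the (l r) (i, True) = the (l (r + gen i)) (i, False) \<and>
             the (l r) (i, False) = the (l (r - gen i)) (i, True))}\<rparr>"

text \<open>The colorings of this problem are exactly the proper edge colorings of the grid.\<close>

definition grid_edges :: "(int ^ 'd::finite) set set" where
  "grid_edges = {{u, v} | u v. adj u v}"

definition proper_edge_coloring :: "nat \<Rightarrow> ((int ^ 'd::finite) set \<Rightarrow> nat) \<Rightarrow> bool" where
  "proper_edge_coloring k \<gamma> \<longleftrightarrow> \<gamma> ` grid_edges \<subseteq> {..<k} \<and>
     (\<forall>e\<in>grid_edges. \<forall>e'\<in>grid_edges. e \<noteq> e' \<and> e \<inter> e' \<noteq> {} \<longrightarrow> \<gamma> e \<noteq> \<gamma> e')"

definition incident_edge :: "int ^ 'd::finite \<Rightarrow> 'd \<times> bool \<Rightarrow> (int ^ 'd) set" where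
  "incident_edge v = (\<lambda>(i, b). if b then {v, v + gen i} else {v - gen i, v})"

lemma incident_edge_in: "incident_edge v p \<in> grid_edges"
  unfolding grid_edges_def incident_edge_def adj_def
  by (auto split: prod.split) (metis diff_add_cancel)+

lemma grid_edges_cases:
  assumes "e \<in> grid_edges" "v \<in> e"
  obtains p where "e = incident_edge v p"
proof -
  obtain a i where e: "e = {a, a + gen i}"
    using assms(1) by (auto simp: grid_edges_def adj_def insert_commute)
  then consider "v = a" | "v = a + gen i" using assms(2) by auto
  then show ?thesis
  proof cases
    case 1
    then have "e = incident_edge v (i, True)" by (simp add: e incident_edge_def)
    then show ?thesis by (rule that)
  next
    case 2
    then have "e = incident_edge v (i, False)" by (simp add: e incident_edge_def)
    then show ?thesis by (rule that)
  qed
qed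

lemma inj_incident_edge: "inj (incident_edge (v :: int ^ 'd::finite))"
proof (rule injI)
  have gen: "gen i = gen j \<longleftrightarrow> i = j" "gen i \<noteq> - gen j" "gen i \<noteq> (0 :: int ^ 'd)" for i j :: 'd
    by (auto simp: axis_eq_axis vec_eq_iff axis_def split: if_splits)
  fix p p' assume eq: "incident_edge v p = incident_edge v p'"
  define s where "s = (\<lambda>(i, b). if b then gen i else - gen i :: int ^ 'd)"
  have ie: "incident_edge v p = {v, v + s p}" for p
    by (auto simp: incident_edge_def s_def split: prod.split)
  have "s p = s p'" using eq unfolding ie by (auto simp: doubleton_eq_iff)
  then show "p = p'"
    using gen(2) gen(2)[symmetric] by (auto simp: s_def gen split: if_splits prod.splits)
qed

lemma neighbors_in_hop_ball: "v \<in> hop_ball v 1" "v + gen i \<in> hop_ball v 1" "v - gen i \<in> hop_ball v 1"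
proof -
  have "gdist v u \<le> 1" if "adj v u" for u
    unfolding gdist_def by (rule Least_le) (use that in \<open>simp only: relpowp_1\<close>)
  moreover have "adj v (v + gen i)" "adj v (v - gen i)"
    by (auto simp: adj_def)
  moreover have "gdist v v \<le> 0"
    unfolding gdist_def by (rule Least_le) simp
  ultimately show "v \<in> hop_ball v 1" "v + gen i \<in> hop_ball v 1" "v - gen i \<in> hop_ball v 1"
    by (auto simp: hop_ball_def)
qed

lemma is_coloring_proper_edge_coloring_lcl_iff:
  fixes f :: "int ^ 'd::finite \<rightharpoonup> ('d \<times> bool \<Rightarrow> nat)"
  shows "is_coloring (proper_edge_coloring_lcl k) f \<longleftrightarrow>
    (\<exists>\<gamma>. proper_edge_coloring k \<gamma> \<and> f = (\<lambda>v. Some (\<gamma> \<circ> incident_edge v)))"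
proof -
  have col: "is_coloring (proper_edge_coloring_lcl k) (\<lambda>v. Some (g v)) \<longleftrightarrow>
     (\<forall>v. range (g v) \<subseteq> {..<k}) \<and> (\<forall>v. inj (g v)) \<and>
     (\<forall>v i. g v (i, True) = g (v + gen i) (i, False) \<and> g v (i, False) = g (v - gen i) (i, True))"
    (is "_ \<longleftrightarrow> ?R1 \<and> ?R2 \<and> ?R3")
    for g :: "int ^ 'd \<Rightarrow> 'd \<times> bool \<Rightarrow> nat"
  proof -
    let ?f = "\<lambda>v. Some (g v)"
    have "ran (?f |` hop_ball v 1) \<subseteq> edge_outputs k" if ?R1 for v
      using that by (auto simp: ran_def restrict_map_def edge_outputs_def split: if_splits)
    moreover have "ran ?f \<subseteq> edge_outputs k \<longleftrightarrow> ?R1"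
      by (auto simp: ran_def edge_outputs_def)
    moreover have "dom (?f |` hop_ball v 1) = hop_ball v 1" for v
      by (auto simp: dom_def restrict_map_def)
    moreover have "(v, ?f |` hop_ball v 1) \<in> allowed (proper_edge_coloring_lcl k) \<longleftrightarrow>
        dom (?f |` hop_ball v 1) = hop_ball v 1 \<and> ran (?f |` hop_ball v 1) \<subseteq> edge_outputs k \<and>
        inj (g v) \<and> (\<forall>i. g v (i, True) = g (v + gen i) (i, False) \<and> g v (i, False) = g (v - gen i) (i, True))"
      for v
      unfolding proper_edge_coloring_lcl_def lcl.simps mem_Collect_eq prod.case
      by (simp only: restrict_in neighbors_in_hop_ball option.sel)
    moreover have "outputs (proper_edge_coloring_lcl k) = edge_outputs k"
      "radius (proper_edge_coloring_lcl k) = 1" "dom ?f = UNIV"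
      by (auto simp: proper_edge_coloring_lcl_def)
    ultimately show ?thesis
      unfolding is_coloring_def by metis
  qed
  show ?thesis
  proof
    assume f: "is_coloring (proper_edge_coloring_lcl k) f"
    define g where "g = (\<lambda>v. the (f v))"
    have "dom f = UNIV" using f by (simp add: is_coloring_def)
    then have fg: "f = (\<lambda>v. Some (g v))"
      by (auto simp: g_def dom_def set_eq_iff)
    have g: "range (g v) \<subseteq> {..<k}" "inj (g v)"
      "g v (i, True) = g (v + gen i) (i, False)" "g v (i, False) = g (v - gen i) (i, True)" for v i
      using f[unfolded fg col] by blast+
    define h where "h = (\<lambda>e :: (int ^ 'd) set. SOME vp. e = case_prod incident_edge vp)"
    define \<gamma> where "\<gamma> = (\<lambda>e. case_prod g (h e))"
    have val: "g u q = g v p" if eq: "incident_edge u q = incident_edge v p" for u q v p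
    proof (cases "u = v")
      case True
      then show ?thesis using eq inj_incident_edge[of v] by (auto dest: injD)
    next
      case False
      obtain i b where p: "p = (i, b)" by (cases p)
      show ?thesis
      proof (cases b)
        case True
        have u: "u = v + gen i"
          using eq \<open>u \<noteq> v\<close> p True by (auto simp: incident_edge_def doubleton_eq_iff split: prod.splits if_splits)
        then have "incident_edge u q = incident_edge u (i, False)"
          using eq p True by (simp add: incident_edge_def)
        then have "q = (i, False)" using inj_incident_edge by (auto dest: injD)
        then show ?thesis using g(3)[of v i] u p True by simp
      next
        case False
        have u: "u = v - gen i"
          using eq \<open>u \<noteq> v\<close> p False by (auto simp: incident_edge_def doubleton_eq_iff split: prod.splits if_splits)
        then have "incident_edge u q = incident_edge u (i, True)"
          using eq p False by (simp add: incident_edge_def)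
        then have "q = (i, True)" using inj_incident_edge by (auto dest: injD)
        then show ?thesis using g(4)[of v i] u p False by simp
      qed
    qed
    have \<gamma>: "\<gamma> (incident_edge v p) = g v p" for v p
    proof -
      have "incident_edge v p = case_prod incident_edge (h (incident_edge v p))"
        unfolding h_def by (rule someI[of _ "(v, p)"]) simp
      then show ?thesis unfolding \<gamma>_def using val by (metis case_prod_beta)
    qed
    have "proper_edge_coloring k \<gamma>"
      unfolding proper_edge_coloring_def
    proof (intro conjI ballI impI subsetI)
      fix c assume "c \<in> \<gamma> ` grid_edges"
      then obtain e v where e: "e \<in> grid_edges" "v \<in> e" "c = \<gamma> e"
        by (auto simp: grid_edges_def)
      then obtain p where "e = incident_edge v p" using grid_edges_cases by blast
      then show "c \<in> {..<k}" using e(3) \<gamma> g(1)[of v] by (metis rangeI subsetD)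
    next
      fix e e' :: "(int ^ 'd) set"
      assume e: "e \<in> grid_edges" "e' \<in> grid_edges" "e \<noteq> e' \<and> e \<inter> e' \<noteq> {}"
      then obtain v where "v \<in> e" "v \<in> e'" by auto
      then obtain p p' where "e = incident_edge v p" "e' = incident_edge v p'"
        using e grid_edges_cases by metis
      then show "\<gamma> e \<noteq> \<gamma> e'" using e \<gamma> g(2)[of v] by (auto dest: injD)
    qed
    moreover have "f = (\<lambda>v. Some (\<gamma> \<circ> incident_edge v))"
      unfolding fg by (simp only: \<gamma> comp_def)
    ultimately show "\<exists>\<gamma>. proper_edge_coloring k \<gamma> \<and> f = (\<lambda>v. Some (\<gamma> \<circ> incident_edge v))"
      by blast
  next
    assume "\<exists>\<gamma>. proper_edge_coloring k \<gamma> \<and> f = (\<lambda>v. Some (\<gamma> \<circ> incident_edge v))"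
    then obtain \<gamma> where \<gamma>: "proper_edge_coloring k \<gamma>" and f: "f = (\<lambda>v. Some (\<gamma> \<circ> incident_edge v))"
      by blast
    have "range (\<gamma> \<circ> incident_edge v) \<subseteq> {..<k}" for v
      using \<gamma> incident_edge_in by (fastforce simp: proper_edge_coloring_def)
    moreover have "inj (\<gamma> \<circ> incident_edge v)" for v
    proof (rule injI)
      fix p p' assume "(\<gamma> \<circ> incident_edge v) p = (\<gamma> \<circ> incident_edge v) p'"
      moreover have "v \<in> incident_edge v p \<inter> incident_edge v p'"
        by (auto simp: incident_edge_def split: prod.split)
      ultimately have "incident_edge v p = incident_edge v p'"
        using \<gamma> incident_edge_in unfolding proper_edge_coloring_def by (metis comp_apply empty_iff)
      then show "p = p'" using inj_incident_edge by (auto dest: injD)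
    qed
    ultimately show "is_coloring (proper_edge_coloring_lcl k) f"
      unfolding f col by (simp add: incident_edge_def)
  qed
qed

end

theory Submission
  imports Defs "HOL-Combinatorics.Transposition"
begin

text \<open>
  In the standard coloring with phase \<open>p \<in> {0, 1}\<^sup>d\<close>, each line in direction \<open>i\<close> alternates between the
  colors \<open>2 i\<close> and \<open>2 i + 1\<close>, starting as \<open>p\<^sub>i\<close> prescribes.  The algorithm keeps the invariant that
  the coloring of a piece extends to a proper coloring of the whole grid that is standard, of some
  phase, outside the piece.  To color a piece, it suffices to change, near each maximal subpiece and
  one direction at a time, the phase there to a common one.  Direction \<open>i\<close> is handled across the
  boundary of a union of aligned cubes of side 2: the lines in direction \<open>i\<close> cross it in adjacent
  pairs, which are separated by a fixed other direction \<open>j\<close>, and at each crossing the colors of the two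
  crossing edges are exchanged with those of the two edges in direction \<open>j\<close> that complete the 4-cycle.
\<close>

section \<open>Proper colorings and the standard colorings\<close>

text \<open>Agreement is demanded only along outgoing edges; taken at \<open>v - gen i\<close> it
  gives agreement along incoming ones.\<close>

definition proper_output :: "(int ^ 'd::finite \<Rightarrow> 'd \<times> bool \<Rightarrow> nat) \<Rightarrow> bool" where
  "proper_output f \<longleftrightarrow>
     (\<forall>v. range (f v) \<subseteq> {..<2 * CARD('d)} \<and> inj (f v)) \<and>
     (\<forall>v i. f v (i, True) = f (v + gen i) (i, False))"

definition dir_index :: "'d::finite \<Rightarrow> nat" where
  "dir_index = (SOME h :: 'd \<Rightarrow> nat. bij_betw h UNIV {0..<CARD('d)})"

lemma dir_index: "bij_betw (dir_index :: 'd::finite \<Rightarrow> nat) UNIV {0..<CARD('d)}"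
  unfolding dir_index_def
  by (rule someI_ex[OF ex_bij_betw_finite_nat[OF finite]])

lemma dir_index_less: "dir_index (i :: 'd::finite) < CARD('d)"
  using dir_index[where 'd = 'd] by (auto simp: bij_betw_def)

lemma dir_index_eq_iff: "dir_index i = dir_index j \<longleftrightarrow> i = j"
  using dir_index by (auto simp: bij_betw_def dest: injD)

text \<open>Phases are integer vectors of which only the parities matter. Flipping direction
  \<open>i\<close> is then adding \<open>gen i\<close>, and translating the grid by \<open>t\<close>
  adds \<open>t\<close> to the phase.\<close>

definition std_coloring :: "int ^ 'd::finite \<Rightarrow> int ^ 'd \<Rightarrow> 'd \<times> bool \<Rightarrow> nat" where
  "std_coloring p v = (\<lambda>(i, b). 2 * dir_index i + (if b = even (v $ i + p $ i) then 0 else 1))"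

lemma proper_output_std_coloring: "proper_output (std_coloring (p :: int ^ 'd::finite))"
proof -
  have "inj (std_coloring p v)" for v
  proof (rule injI)
    fix x y assume eq: "std_coloring p v x = std_coloring p v y"
    obtain i a j b where x: "x = (i, a)" and y: "y = (j, b)" by (cases x, cases y)
    have *: "2 * m + (if P then 0 else 1) = 2 * n + (if Q then 0 else 1) \<longleftrightarrow> m = n \<and> P = Q"
      for m n :: nat and P Q by auto presburger+
    have "i = j \<and> (a = even (v $ i + p $ i)) = (b = even (v $ j + p $ j))"
      using eq unfolding std_coloring_def x y prod.case * dir_index_eq_iff .
    then have "i = j \<and> a = b" by metis
    then show "x = y" by (simp add: x y)
  qed
  moreover have "range (std_coloring p v) \<subseteq> {..<2 * CARD('d)}" for v
  proof -
    have "2 * dir_index i + (if P then 0 else 1) < 2 * CARD('d)" for i :: 'd and P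
      using dir_index_less[of i] by auto
    then show ?thesis by (auto simp: std_coloring_def split: prod.split)
  qed
  moreover have "std_coloring p v (i, True) = std_coloring p (v + gen i) (i, False)" for v i
    by (simp add: std_coloring_def axis_def)
  ultimately show ?thesis by (auto simp: proper_output_def)
qed

lemma std_coloring_eqI:
  assumes "even (v $ i + p $ i + w $ i + p' $ i)"
  shows "std_coloring p v (i, b) = std_coloring p' w (i, b)"
  using assms by (auto simp: std_coloring_def)

lemma std_coloring_translate: "std_coloring p (v + t) = std_coloring (p + t) v"
  by (simp add: std_coloring_def add_ac)

section \<open>Changing the phase across a boundary\<close>

text \<open>The aligned cubes are the fibres of \<open>div 2\<close> in all coordinates: an edge
  going up from an even coordinate stays in its cube, one going up from an odd coordinate leaves
  it.\<close>

definition block_closed :: "(int ^ 'd::finite) set \<Rightarrow> bool" where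
  "block_closed C \<longleftrightarrow> (\<forall>u v. (\<forall>i. u $ i div 2 = v $ i div 2) \<longrightarrow> u \<in> C \<longrightarrow> v \<in> C)"

lemma block_closed_add_gen:
  assumes "block_closed C" "even (v $ i)"
  shows "v + gen i \<in> C \<longleftrightarrow> v \<in> C"
proof -
  have "(v + gen i) $ k div 2 = v $ k div 2" for k
    using assms(2) by (auto simp: axis_def)
  then show ?thesis using assms(1) unfolding block_closed_def by metis
qed

text \<open>Switching the phase outside \<open>C\<close> spoils only the edges in direction
  \<open>i\<close> across the boundary of \<open>C\<close>. In the 4-cycle of such an edge, the two
  edges in direction \<open>j\<close> have equal colors, since these do not depend on the phase in
  direction \<open>i\<close>; the exchange gives this color to the crossing edges, and each edge in
  direction \<open>j\<close> gets the color that its own side of \<open>C\<close> had for the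
  crossing edges. Keeping \<open>B\<close> one step inside \<open>C\<close> makes the coloring
  standard at all crossings.\<close>

lemma flip_phase:
  fixes f :: "int ^ 'd::finite \<Rightarrow> 'd \<times> bool \<Rightarrow> nat"
  assumes f: "proper_output f" and out: "\<And>v. v \<notin> B \<Longrightarrow> f v = std_coloring p v"
    and C: "block_closed C" and BC: "B \<subseteq> C"
    and nb: "\<And>v k. v \<in> B \<Longrightarrow> v + gen k \<in> C \<and> v - gen k \<in> C" and ij: "i \<noteq> j"
  obtains f' where "proper_output f'" "\<And>v. v \<in> B \<Longrightarrow> f' v = f v"
    "\<And>v. v \<notin> C \<Longrightarrow> v + gen i \<notin> C \<Longrightarrow> v - gen i \<notin> C \<Longrightarrow> f' v = std_coloring (p + gen i) v"
proof -
  txt \<open>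
    By alignment, an edge at \<open>v\<close> in direction \<open>i\<close> can leave or enter \<open>C\<close> only if it goes up from an odd
    or down from an even coordinate; the partner of \<open>v\<close> in direction \<open>j\<close> is the other vertex of its cube.
  \<close>
  define crossing where
    "crossing v \<longleftrightarrow> (v \<in> C) \<noteq> ((if odd (v $ i) then v + gen i else v - gen i) \<in> C)" for v
  define h where "h v = (if v \<in> C then f v else std_coloring (p + gen i) v)" for v
  define f' where
    \<comment> \<open>A transposition only permutes the outputs at a vertex, so injectivity and
      range carry over from \<open>h\<close>.\<close>
    "f' v = (if crossing v then h v \<circ> transpose (i, odd (v $ i)) (j, even (v $ j)) else h v)" for v
  have step: "std_coloring p v (k, True) = std_coloring p (v + gen k) (k, False)" for p v :: "int ^ 'd" and k
    using proper_output_std_coloring[of p] by (simp add: proper_output_def)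
  have h_out: "h v = std_coloring (if v \<in> C then p else p + gen i) v" if "v \<notin> B" for v
    using out that by (simp add: h_def)
  \<comment> \<open>The phases \<open>p\<close> and \<open>p + gen i\<close> differ only in
    direction \<open>i\<close>, and an edge across the boundary of \<open>C\<close> has both ends
    outside \<open>B\<close>, where \<open>h\<close> is standard.\<close>
  have h_step: "h v (k, True) = h (v + gen k) (k, False)" if "k \<noteq> i \<or> (v \<in> C \<longleftrightarrow> v + gen k \<in> C)" for v k
  proof (cases "v \<in> C \<longleftrightarrow> v + gen k \<in> C")
    case True
    then show ?thesis using f step by (auto simp: h_def proper_output_def)
  next
    case False
    then have "k \<noteq> i" using that by auto
    have "v \<notin> B" "v + gen k \<notin> B" using False nb[of v k] nb[of "v + gen k" k] BC by auto
    then show ?thesis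
      unfolding h_out[OF \<open>v \<notin> B\<close>] h_out[OF \<open>v + gen k \<notin> B\<close>]
      using \<open>k \<noteq> i\<close> step[of p v k] by (auto simp: std_coloring_def axis_def)
  qed
  have cross_B: "v \<notin> B" if "crossing v" for v
    using that nb[of v i] BC by (auto simp: crossing_def split: if_splits)
  have tr: "f' v x = h v x" if "x \<noteq> (i, odd (v $ i))" "x \<noteq> (j, even (v $ j))" for v x
    using that by (simp add: f'_def)
  have tr1: "f' v (i, odd (v $ i)) = h v (j, even (v $ j))"
    and tr2: "f' v (j, even (v $ j)) = h v (i, odd (v $ i))" if "crossing v" for v
    using that by (simp_all add: f'_def)
  have tr3: "f' v = h v" if "\<not> crossing v" for v
    using that by (simp add: f'_def)
  have "f' v (k, True) = f' (v + gen k) (k, False)" for v k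
  proof -
    let ?w = "v + gen k"
    consider "k = i" "odd (v $ i)" | "k = i" "even (v $ i)" | "k = j" "even (v $ j)"
      | "k = j" "odd (v $ j)" | "k \<noteq> i" "k \<noteq> j" by blast
    then show ?thesis
    proof cases
      case 1
      have w: "even (?w $ i)" "?w $ j = v $ j" using 1 ij by (auto simp: axis_def)
      have cr: "crossing v \<longleftrightarrow> (v \<in> C) \<noteq> (?w \<in> C)" "crossing ?w \<longleftrightarrow> (v \<in> C) \<noteq> (?w \<in> C)"
        using 1 w by (auto simp: crossing_def)
      show ?thesis
      proof (cases "crossing v")
        case True
        then have "crossing ?w" using cr by simp
        \<comment> \<open>Both ends of the crossing edge take over a color of direction
          \<open>j\<close>, which is the same on the two sides of \<open>C\<close>.\<close>
        have "h v (j, even (v $ j)) = h ?w (j, even (v $ j))"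
          unfolding h_out[OF cross_B[OF True]] h_out[OF cross_B[OF \<open>crossing ?w\<close>]]
          using ij 1 by (intro std_coloring_eqI) (auto simp: axis_def)
        then show ?thesis using tr1[OF True] tr1[OF \<open>crossing ?w\<close>] 1 w by simp
      next
        case False
        then have "\<not> crossing ?w" using cr by simp
        then show ?thesis using False cr tr3 h_step[of k v] by simp
      qed
    next
      case 2
      \<comment> \<open>This edge stays inside a cube, so the transposition at either end leaves it
        alone.\<close>
      then have "odd (?w $ i)" by (auto simp: axis_def)
      moreover have "?w \<in> C \<longleftrightarrow> v \<in> C" using block_closed_add_gen[OF C] 2 by simp
      ultimately show ?thesis using 2 ij h_step[of k v] by (simp add: tr)
    next
      case 3
      have w: "odd (?w $ j)" "?w $ i = v $ i" using 3 ij by (auto simp: axis_def)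
      have C_eq: "?w \<in> C \<longleftrightarrow> v \<in> C" using block_closed_add_gen[OF C] 3 by simp
      have "even ((v + gen i) $ j)" "even ((v - gen i) $ j)" using 3 ij by (auto simp: axis_def)
      then have "?w + gen i \<in> C \<longleftrightarrow> v + gen i \<in> C" "?w - gen i \<in> C \<longleftrightarrow> v - gen i \<in> C"
        using block_closed_add_gen[OF C, of "v + gen i" j] block_closed_add_gen[OF C, of "v - gen i" j] 3
        by (simp_all add: algebra_simps)
      then have cr: "crossing ?w \<longleftrightarrow> crossing v" using w C_eq by (simp add: crossing_def)
      show ?thesis
      proof (cases "crossing v")
        case True
        then have "crossing ?w" using cr by simp
        \<comment> \<open>The vertex \<open>v\<close> and its partner lie on the same side of
          \<open>C\<close> and share the coordinate \<open>i\<close>, so both hand the same color of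
          direction \<open>i\<close> to the edge between them.\<close>
        have "h v (i, odd (v $ i)) = h ?w (i, odd (v $ i))"
          unfolding h_out[OF cross_B[OF True]] h_out[OF cross_B[OF \<open>crossing ?w\<close>]] C_eq
          using w by (intro std_coloring_eqI) auto
        then show ?thesis using tr2[OF True] tr2[OF \<open>crossing ?w\<close>] 3 w by simp
      next
        case False
        then show ?thesis using cr tr3 h_step[of k v] C_eq by simp
      qed
    next
      case 4
      \<comment> \<open>An edge in direction \<open>j\<close> between two cubes is moved at neither
        end.\<close>
      then have "even (?w $ j)" by (auto simp: axis_def)
      then show ?thesis using 4 ij h_step[of k v] by (simp add: tr)
    next
      case 5
      then show ?thesis using h_step[of k v] by (simp add: tr)
    qed
  qed
  moreover have h_prop: "inj (h v)" "range (h v) \<subseteq> {..<2 * CARD('d)}" for v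
    using f proper_output_std_coloring[of "p + gen i"] by (auto simp: h_def proper_output_def)
  have "inj (f' v)" for v
    using h_prop(1)[of v] by (auto simp: f'_def intro: inj_compose)
  moreover have "range (f' v) \<subseteq> {..<2 * CARD('d)}" for v
    using h_prop(2)[of v] by (auto simp: f'_def)
  ultimately have "proper_output f'" by (simp add: proper_output_def)
  moreover have "f' v = f v" if "v \<in> B" for v
    using that cross_B[of v] BC by (auto simp: f'_def h_def)
  moreover have "f' v = std_coloring (p + gen i) v" if "v \<notin> C" "v + gen i \<notin> C" "v - gen i \<notin> C" for v
    using that by (auto simp: f'_def h_def crossing_def)
  ultimately show thesis using that by blast
qed

text \<open>Distance is measured between cubes, in the maximum norm, so that every such
  neighbourhood is a union of cubes; \<open>thicken 0 D\<close> is the smallest such union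
  containing \<open>D\<close>.\<close>

definition thicken :: "nat \<Rightarrow> (int ^ 'd::finite) set \<Rightarrow> (int ^ 'd) set" where
  "thicken m D = {v. \<exists>u\<in>D. \<forall>i. \<bar>v $ i div 2 - u $ i div 2\<bar> \<le> int m}"

lemma block_closed_thicken: "block_closed (thicken m D)"
  by (auto simp: block_closed_def thicken_def)

lemma thicken_mono: "m \<le> n \<Longrightarrow> thicken m D \<subseteq> thicken n D"
  unfolding thicken_def by (clarsimp, rule bexI) (auto intro: order_trans)

lemma subset_thicken: "D \<subseteq> thicken m D"
proof
  fix x assume "x \<in> D"
  then show "x \<in> thicken m D" unfolding thicken_def by (intro CollectI bexI[of _ x]) auto
qed

lemma thicken_step:
  assumes "v \<in> thicken m D"
  shows "v + gen k \<in> thicken (Suc m) D" "v - gen k \<in> thicken (Suc m) D"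
proof -
  obtain u where u: "u \<in> D" "\<And>i. \<bar>v $ i div 2 - u $ i div 2\<bar> \<le> int m"
    using assms by (auto simp: thicken_def)
  have *: "\<bar>(x + 1) div 2 - y\<bar> \<le> 1 + int m" "\<bar>(x - 1) div 2 - y\<bar> \<le> 1 + int m"
    if "\<bar>x div 2 - y\<bar> \<le> int m" for x y :: int
    using that by linarith+
  have "\<bar>(v + gen k) $ i div 2 - u $ i div 2\<bar> \<le> int (Suc m)" for i
    using u(2)[of i] *(1)[OF u(2)[of i]] by (cases "i = k") (simp_all add: axis_def)
  then show "v + gen k \<in> thicken (Suc m) D"
    unfolding thicken_def using u(1) by blast
  have "\<bar>(v - gen k) $ i div 2 - u $ i div 2\<bar> \<le> int (Suc m)" for i
    using u(2)[of i] *(2)[OF u(2)[of i]] by (cases "i = k") (simp_all add: axis_def)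
  then show "v - gen k \<in> thicken (Suc m) D"
    unfolding thicken_def using u(1) by blast
qed

lemma thicken_step_iff:
  assumes "v + gen k \<in> thicken m D \<or> v - gen k \<in> thicken m D"
  shows "v \<in> thicken (Suc m) D"
  using assms thicken_step(2)[of "v + gen k" m D k] thicken_step(1)[of "v - gen k" m D k] by auto

text \<open>One application of \<open>flip_phase\<close> for each direction in which the phases
  differ in parity. It costs two layers of cubes: the first surrounds the part to be kept, and the
  second contains the vertices just outside it that the exchange recolors.\<close>

lemma change_phase:
  fixes f :: "int ^ 'd::finite \<Rightarrow> 'd \<times> bool \<Rightarrow> nat"
  assumes card: "CARD('d) > 1" and "finite I"
    and "proper_output f" "\<And>v. v \<notin> thicken m D \<Longrightarrow> f v = std_coloring p v"
    and "{k. odd (p $ k + p' $ k)} \<subseteq> I"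
  shows "\<exists>f'. proper_output f' \<and> (\<forall>v\<in>thicken m D. f' v = f v) \<and>
    (\<forall>v. v \<notin> thicken (m + 2 * card I) D \<longrightarrow> f' v = std_coloring p' v)"
  using assms(2-)
proof (induction I arbitrary: f p m rule: finite_induct)
  case empty
  have "std_coloring p v = std_coloring p' v" for v
  proof
    fix x :: "'d \<times> bool"
    show "std_coloring p v x = std_coloring p' v x"
      using empty.prems(3) by (cases x) (auto intro!: std_coloring_eqI)
  qed
  then show ?case using empty.prems by (intro exI[of _ f]) auto
next
  case (insert i I)
  show ?case
  proof (cases "odd (p $ i + p' $ i)")
    case True
    \<comment> \<open>A second direction exists because the dimension exceeds 1.\<close>
    obtain j where "i \<noteq> j" using card by (metis card_1_singleton_iff UNIV_eq_I One_nat_def less_irrefl singletonI)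
    obtain f1 where f1: "proper_output f1" "\<And>v. v \<in> thicken m D \<Longrightarrow> f1 v = f v"
      "\<And>v. v \<notin> thicken (Suc m) D \<Longrightarrow> v + gen i \<notin> thicken (Suc m) D \<Longrightarrow>
         v - gen i \<notin> thicken (Suc m) D \<Longrightarrow> f1 v = std_coloring (p + gen i) v"
      by (rule flip_phase[OF insert.prems(1,2) block_closed_thicken[of "Suc m" D] thicken_mono _ \<open>i \<noteq> j\<close>])
        (auto intro: thicken_step)
    have "f1 v = std_coloring (p + gen i) v" if "v \<notin> thicken (Suc (Suc m)) D" for v
      using that thicken_step_iff thicken_mono[of "Suc m" "Suc (Suc m)" D] by (intro f1(3)) auto
    moreover have "{k. odd ((p + gen i) $ k + p' $ k)} \<subseteq> I"
      using True insert.prems(3) by (auto simp: axis_def)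
    ultimately obtain f' where f': "proper_output f'" "\<forall>v\<in>thicken (Suc (Suc m)) D. f' v = f1 v"
      "\<forall>v. v \<notin> thicken (Suc (Suc m) + 2 * card I) D \<longrightarrow> f' v = std_coloring p' v"
      using insert.IH[OF f1(1)] by blast
    have "thicken m D \<subseteq> thicken (Suc (Suc m)) D" by (rule thicken_mono) simp
    then have "\<forall>v\<in>thicken m D. f' v = f v" using f' f1 by auto
    then show ?thesis using f' insert.hyps by auto
  next
    case False
    then have "{k. odd (p $ k + p' $ k)} \<subseteq> I" using insert.prems by auto
    then obtain f' where f': "proper_output f'" "\<forall>v\<in>thicken m D. f' v = f v"
      "\<forall>v. v \<notin> thicken (m + 2 * card I) D \<longrightarrow> f' v = std_coloring p' v"
      using insert.IH[OF insert.prems(1,2)] by blast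
    have "thicken (m + 2 * card I) D \<subseteq> thicken (m + 2 * card (insert i I)) D"
      using insert.hyps by (intro thicken_mono) simp
    then show ?thesis using f' by blast
  qed
qed

text \<open>Being proper is a condition on single vertices and single edges. The extra layer in the
  separation hypothesis lets no edge join two of the regions, so each edge sees either one
  \<open>F D\<close> or the common standard coloring.\<close>

lemma glue_colorings:
  assumes F: "\<And>D. D \<in> M \<Longrightarrow> proper_output (F D)"
    and out: "\<And>D v. D \<in> M \<Longrightarrow> v \<notin> thicken r D \<Longrightarrow> F D v = std_coloring p v"
    and sep: "\<And>D E. D \<in> M \<Longrightarrow> E \<in> M \<Longrightarrow> D \<noteq> E \<Longrightarrow> thicken (Suc r) D \<inter> thicken r E = {}"
  shows "\<exists>f. proper_output f \<and> (\<forall>D\<in>M. \<forall>v\<in>thicken r D. f v = F D v) \<and>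
    (\<forall>v. (\<forall>D\<in>M. v \<notin> thicken r D) \<longrightarrow> f v = std_coloring p v)"
proof -
  define f where
    "f v = (if \<exists>D\<in>M. v \<in> thicken r D then F (SOME D. D \<in> M \<and> v \<in> thicken r D) v else std_coloring p v)" for v
  \<comment> \<open>On the extra layer around \<open>D\<close> no other region interferes, and both
    colorings are standard there.\<close>
  have f1: "f v = F D v" if D: "D \<in> M" and v: "v \<in> thicken (Suc r) D" for D v
  proof (cases "\<exists>E\<in>M. v \<in> thicken r E")
    case True
    then have E: "E \<in> M \<and> v \<in> thicken r E \<Longrightarrow> E = D" for E using sep[of D E] D v by auto
    then have "(SOME D. D \<in> M \<and> v \<in> thicken r D) = D" using True by (metis (lifting) someI_ex)
    then show ?thesis using True by (simp add: f_def)
  next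
    case False
    then show ?thesis using out D by (simp add: f_def)
  qed
  have mono: "thicken r D \<subseteq> thicken (Suc r) D" for D :: "(int ^ 'a) set" by (rule thicken_mono) simp
  have f2: "f v = std_coloring p v" if "\<And>D. D \<in> M \<Longrightarrow> v \<notin> thicken r D" for v
    using that by (auto simp: f_def)
  have vert: "\<exists>g. proper_output g \<and> f v = g v" for v
  proof (cases "\<exists>D\<in>M. v \<in> thicken r D")
    case True
    then obtain D where "D \<in> M" "v \<in> thicken (Suc r) D" using mono by blast
    then show ?thesis using f1 F by blast
  next
    case False
    then have "f v = std_coloring p v" using f2 by blast
    then show ?thesis using proper_output_std_coloring by blast
  qed
  have edge: "\<exists>g. proper_output g \<and> f v = g v \<and> f (v + gen i) = g (v + gen i)" for v i
  proof (cases "\<exists>D\<in>M. v \<in> thicken r D \<or> v + gen i \<in> thicken r D")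
    case True
    then obtain D where "D \<in> M" "v \<in> thicken (Suc r) D" "v + gen i \<in> thicken (Suc r) D"
      using thicken_step(1)[of v r _ i] thicken_step_iff[of v i r] mono by blast
    then have "f v = F D v" "f (v + gen i) = F D (v + gen i)" "proper_output (F D)"
      using f1 F by auto
    then show ?thesis by blast
  next
    case False
    then have "f v = std_coloring p v" "f (v + gen i) = std_coloring p (v + gen i)" using f2 by auto
    then show ?thesis using proper_output_std_coloring by blast
  qed
  have "range (f v) \<subseteq> {..<2 * CARD('a)}" "inj (f v)" for v
    using vert[of v] unfolding proper_output_def by (metis, metis)
  moreover have "f v (i, True) = f (v + gen i) (i, False)" for v i
    using edge[of v i] unfolding proper_output_def by metis
  ultimately have "proper_output f" by (simp add: proper_output_def)
  moreover have "f v = F D v" if "D \<in> M" "v \<in> thicken r D" for D v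
    using that f1 mono by blast
  ultimately show ?thesis using f2 by blast
qed

section \<open>Distances between pieces\<close>

lemma adj_sym: "adj u v \<Longrightarrow> adj v u"
  by (auto simp: adj_def)

lemma adj_relpowp_sym: "(adj ^^ n) u v \<Longrightarrow> (adj ^^ n) v u"
proof (induction n arbitrary: v)
  case (Suc n)
  then obtain w where "(adj ^^ n) u w" "adj w v" by auto
  then show ?case using Suc.IH adj_sym by (intro relpowp_Suc_I2) auto
qed simp

lemma adj_relpowp_trans: "(adj ^^ m) u v \<Longrightarrow> (adj ^^ n) v w \<Longrightarrow> (adj ^^ (m + n)) u w"
  by (auto simp: relpowp_add)

text \<open>A step towards \<open>v\<close> in a coordinate that still differs lowers the sum by
  one. Since walks therefore join any two vertices, the minimum in \<open>gdist\<close> is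
  attained.\<close>

lemma adj_relpowp_l1_dist:
  fixes u v :: "int ^ 'd::finite"
  shows "(\<Sum>i\<in>UNIV. nat \<bar>v $ i - u $ i\<bar>) = n \<Longrightarrow> (adj ^^ n) u v"
proof (induction n arbitrary: u)
  case 0
  then show ?case by (simp add: vec_eq_iff)
next
  case (Suc n)
  then obtain i where i: "v $ i \<noteq> u $ i"
    by (metis (no_types, lifting) abs_zero diff_self nat_0_iff nat.distinct(1) order_refl sum.neutral)
  define w where "w = (if v $ i > u $ i then u + gen i else u - gen i)"
  have "(\<Sum>k\<in>UNIV. nat \<bar>v $ k - u $ k\<bar>)
      = nat \<bar>v $ i - u $ i\<bar> + (\<Sum>k\<in>UNIV - {i}. nat \<bar>v $ k - u $ k\<bar>)"
    by (simp add: sum.remove)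
  moreover have "(\<Sum>k\<in>UNIV. nat \<bar>v $ k - w $ k\<bar>)
      = nat \<bar>v $ i - w $ i\<bar> + (\<Sum>k\<in>UNIV - {i}. nat \<bar>v $ k - w $ k\<bar>)"
    by (simp add: sum.remove)
  moreover have "(\<Sum>k\<in>UNIV - {i}. nat \<bar>v $ k - w $ k\<bar>) = (\<Sum>k\<in>UNIV - {i}. nat \<bar>v $ k - u $ k\<bar>)"
    by (intro sum.cong) (auto simp: w_def axis_def)
  moreover have "nat \<bar>v $ i - u $ i\<bar> = Suc (nat \<bar>v $ i - w $ i\<bar>)"
    using i by (auto simp: w_def)
  ultimately have "(\<Sum>k\<in>UNIV. nat \<bar>v $ k - w $ k\<bar>) = n" using Suc.prems by linarith
  then have "(adj ^^ n) w v" by (rule Suc.IH)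
  moreover have "adj u w" by (auto simp: w_def adj_def)
  ultimately show ?case by (rule relpowp_Suc_I2[rotated])
qed

section \<open>Graph distance, balls and boundaries\<close>

lemma gdist_le: "(adj ^^ n) u v \<Longrightarrow> gdist u v \<le> n"
  unfolding gdist_def by (rule Least_le)

lemma adj_relpowp_gdist: "(adj ^^ gdist u v) u v"
  unfolding gdist_def using adj_relpowp_l1_dist[OF refl] by (rule LeastI)

lemma hop_ball_1: "hop_ball r 1 = insert r (range (\<lambda>i. r + gen i) \<union> range (\<lambda>i. r - gen i))"
proof (intro equalityI subsetI)
  fix u assume "u \<in> hop_ball r 1"
  then have "gdist r u = 0 \<or> gdist r u = 1" by (auto simp: hop_ball_def)
  then have "r = u \<or> adj r u" using adj_relpowp_gdist[of r u] by (auto simp del: relpowp.simps(2) simp: relpowp_1)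
  then show "u \<in> insert r (range (\<lambda>i. r + gen i) \<union> range (\<lambda>i. r - gen i))"
    by (auto simp: adj_def image_iff)
next
  fix u assume "u \<in> insert r (range (\<lambda>i. r + gen i) \<union> range (\<lambda>i. r - gen i))"
  then show "u \<in> hop_ball r 1" using neighbors_in_hop_ball[of r] by auto
qed

text \<open>The first edge of the walk that changes sides has its end inside \<open>S\<close> on the
  boundary, whichever side \<open>x\<close> is on.\<close>

lemma walk_meets_bdry:
  "(adj ^^ n) x v \<Longrightarrow> (x \<in> S) \<noteq> (v \<in> S) \<Longrightarrow> \<exists>y\<in>bdry S. \<exists>m\<le>n. (adj ^^ m) x y"
proof (induction n arbitrary: x)
  case 0
  then show ?case by simp
next
  case (Suc n)
  then obtain w where w: "adj x w" "(adj ^^ n) w v" by (meson relpowp_Suc_D2)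
  show ?case
  proof (cases "(w \<in> S) \<noteq> (v \<in> S)")
    case True
    then obtain y m where "y \<in> bdry S" "m \<le> n" "(adj ^^ m) w y" using Suc.IH w by blast
    then show ?thesis using w(1) by (metis Suc_le_mono relpowp_Suc_I2)
  next
    case False
    then consider "x \<in> S" "w \<notin> S" | "x \<notin> S" "w \<in> S" using Suc.prems by blast
    then show ?thesis
    proof cases
      case 1
      then have "x \<in> bdry S" using w by (auto simp: bdry_def)
      moreover have "(adj ^^ 0) x x" by simp
      ultimately show ?thesis by blast
    next
      case 2
      then have "w \<in> bdry S" using w adj_sym by (auto simp: bdry_def)
      moreover have "(adj ^^ 1) x w" using w by (simp only: relpowp_1)
      ultimately show ?thesis by (metis One_nat_def Suc_le_mono le0)
    qed
  qed
qed

text \<open>In both cases \<open>E\<close> separates all of \<open>D\<close> from \<open>v\<close>.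
  Walked backwards from \<open>v\<close>, the walk meets the boundary of \<open>D\<close> at some
  \<open>x\<close>; the stretch between \<open>x\<close> and \<open>v\<close> then has to meet the
  boundary of \<open>E\<close>.\<close>

lemma bdry_distance_le:
  assumes "u \<in> D" "v \<notin> D" "(adj ^^ n) u v" "D \<inter> E = {} \<and> v \<in> E \<or> D \<subseteq> E \<and> v \<notin> E"
  shows "\<exists>x\<in>bdry D. \<exists>y\<in>bdry E. gdist x y \<le> n"
proof -
  obtain x m where x: "x \<in> bdry D" "m \<le> n" "(adj ^^ m) v x"
    using walk_meets_bdry[OF adj_relpowp_sym[OF assms(3)], of D] assms by blast
  then have "x \<in> D" by (simp add: bdry_def)
  then obtain y l where "y \<in> bdry E" "l \<le> m" "(adj ^^ l) x y"
    using walk_meets_bdry[OF adj_relpowp_sym[OF x(3)], of E] assms by blast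
  then show ?thesis using x gdist_le by (meson order_trans)
qed

text \<open>If the halves of two integers, rounded down, differ by at most \<open>m\<close>, the
  integers differ by at most \<open>2 * m + 1\<close>; this is summed over the coordinates.\<close>

lemma thicken_walk:
  fixes D :: "(int ^ 'd::finite) set"
  assumes "v \<in> thicken m D"
  shows "\<exists>u\<in>D. \<exists>n\<le>CARD('d) * (2 * m + 1). (adj ^^ n) u v"
proof -
  obtain u where u: "u \<in> D" "\<And>i. \<bar>v $ i div 2 - u $ i div 2\<bar> \<le> int m"
    using assms by (auto simp: thicken_def)
  have "nat \<bar>v $ i - u $ i\<bar> \<le> 2 * m + 1" for i
    using u(2)[of i] by linarith
  then have "(\<Sum>i\<in>UNIV. nat \<bar>v $ i - u $ i\<bar>) \<le> CARD('d) * (2 * m + 1)"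
    using sum_bounded_above[of UNIV "\<lambda>i. nat \<bar>v $ i - u $ i\<bar>" "2 * m + 1"] by simp
  then show ?thesis using u(1) adj_relpowp_l1_dist[OF refl] by blast
qed

section \<open>Separation of thickened pieces in a toast\<close>

lemma toast_eqI:
  assumes "toast q \<D>" "D \<in> \<D>" "E \<in> \<D>" "x \<in> bdry D" "y \<in> bdry E" "gdist x y \<le> q"
  shows "D = E"
  using assms unfolding toast_def by blast

lemma toast_thicken_subset:
  fixes D :: "(int ^ 'd::finite) set"
  assumes "toast q \<D>" "D \<in> \<D>" "E \<in> \<D>" "D \<subset> E" "CARD('d) * (2 * m + 1) \<le> q"
  shows "thicken m D \<subseteq> E"
proof (rule subsetI, rule ccontr)
  fix v assume v: "v \<in> thicken m D" "v \<notin> E"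
  obtain u n where u: "u \<in> D" "n \<le> CARD('d) * (2 * m + 1)" "(adj ^^ n) u v"
    using thicken_walk[OF v(1)] by blast
  obtain x y where "x \<in> bdry D" "y \<in> bdry E" "gdist x y \<le> n"
    using bdry_distance_le[OF u(1) _ u(3), of E] v assms(4) by blast
  then have "D = E" using assms u(2) by (intro toast_eqI[of q \<D> D E x y]) auto
  then show False using assms(4) by blast
qed

lemma toast_thicken_disjoint:
  fixes D :: "(int ^ 'd::finite) set"
  assumes "toast q \<D>" "D \<in> \<D>" "E \<in> \<D>" "D \<noteq> E" "D \<inter> E = {}"
    "CARD('d) * (2 * m + 1) + CARD('d) * (2 * n + 1) \<le> q"
  shows "thicken m D \<inter> thicken n E = {}"
proof (rule ccontr)
  assume "thicken m D \<inter> thicken n E \<noteq> {}"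
  then obtain v where v: "v \<in> thicken m D" "v \<in> thicken n E" by blast
  obtain u k where u: "u \<in> D" "k \<le> CARD('d) * (2 * m + 1)" "(adj ^^ k) u v"
    using thicken_walk[OF v(1)] by blast
  obtain w l where w: "w \<in> E" "l \<le> CARD('d) * (2 * n + 1)" "(adj ^^ l) w v"
    using thicken_walk[OF v(2)] by blast
  have "(adj ^^ (k + l)) u w"
    using adj_relpowp_trans[OF u(3) adj_relpowp_sym[OF w(3)]] .
  then obtain x y where "x \<in> bdry D" "y \<in> bdry E" "gdist x y \<le> k + l"
    using bdry_distance_le[OF u(1), of w "k + l" E] w(1) assms(5) by blast
  then have "D = E" using assms u(2) w(2) by (intro toast_eqI[of q \<D> D E x y]) auto
  then show False using assms(4) by blast
qed

section \<open>Extending a coloring to a larger piece\<close>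

text \<open>This is the invariant of the algorithm. The phase is left free, which makes the notion
  invariant under translation.\<close>

definition extendable :: "(int ^ 'd::finite) set \<Rightarrow> (int ^ 'd \<rightharpoonup> ('d \<times> bool \<Rightarrow> nat)) \<Rightarrow> bool" where
  "extendable S m \<longleftrightarrow> (\<exists>f p. proper_output f \<and> (\<forall>v. v \<notin> S \<longrightarrow> f v = std_coloring p v) \<and>
     m = (\<lambda>v. if v \<in> S then Some (f v) else None))"

lemma extendable_dom: "extendable S m \<Longrightarrow> dom m = S"
  by (auto simp: extendable_def split: if_splits)

lemma extendable_translate:
  assumes "extendable S m"
  shows "extendable ((\<lambda>v. v + t) ` S) (\<lambda>v. m (v - t))"
proof -
  obtain f p where f: "proper_output f" "\<And>v. v \<notin> S \<Longrightarrow> f v = std_coloring p v"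
    and m: "m = (\<lambda>v. if v \<in> S then Some (f v) else None)"
    using assms by (auto simp: extendable_def)
  have mem: "v \<in> (\<lambda>v. v + t) ` S \<longleftrightarrow> v - t \<in> S" for v
    by (force simp: image_iff)
  have "v + w - t = v - t + w" for v w :: "int ^ 'a" by (simp add: algebra_simps)
  then have "proper_output (\<lambda>v. f (v - t))"
    using f(1) by (simp only: proper_output_def simp_thms)
  moreover have "f (v - t) = std_coloring (p - t) v" if "v - t \<notin> S" for v
    using f(2)[OF that] std_coloring_translate[of p v "- t"] by simp
  ultimately show ?thesis
    unfolding extendable_def mem m by blast
qed

text \<open>The pieces containing \<open>x\<close> form a chain along which the maps extend each
  other, so the value at \<open>x\<close> is unique.\<close>

lemma map_union_eq_piece:
  assumes "nested_or_disjoint \<D>" "J \<subseteq> \<D>" and dom: "\<And>D. D \<in> J \<Longrightarrow> dom (R D) = D"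
    and le: "\<And>D E. D \<in> J \<Longrightarrow> E \<in> J \<Longrightarrow> D \<subset> E \<Longrightarrow> R D \<subseteq>\<^sub>m R E"
    and D: "D \<in> J" "x \<in> D"
  shows "map_union J R x = R D x"
proof -
  have eq: "R E x = R D x" if "E \<in> J" "x \<in> E" for E
  proof -
    have "D = E \<or> D \<subset> E \<or> E \<subset> D"
      using assms(1,2) that D unfolding nested_or_disjoint_def by blast
    then show ?thesis
    proof (elim disjE)
      assume "D \<subset> E"
      then show ?thesis using le[of D E] that D dom[of D] unfolding map_le_def by metis
    next
      assume "E \<subset> D"
      then show ?thesis using le[of E D] that D dom[of E] unfolding map_le_def by metis
    qed simp
  qed
  obtain y where y: "R D x = Some y" using dom[OF D(1)] D(2) by blast
  have "(THE y. \<exists>E\<in>J. R E x = Some y) = y"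
  proof (rule the_equality)
    show "\<exists>E\<in>J. R E x = Some y" using D y by blast
    fix z assume "\<exists>E\<in>J. R E x = Some z"
    then obtain E where E: "E \<in> J" "R E x = Some z" by blast
    then have "x \<in> E" using dom by blast
    then show "z = y" using eq E y by simp
  qed
  moreover have "\<exists>E\<in>J. x \<in> dom (R E)" using D dom by blast
  ultimately show ?thesis using y by (simp add: map_union_def)
qed

lemma dom_map_union: "dom (map_union J R) = (\<Union>D\<in>J. dom (R D))"
  by (auto simp: map_union_def dom_def)

text \<open>The induction step for one piece: the maximal subpieces carry all the given colors and
  are pairwise disjoint, so their colorings can be brought to phase 0 separately and glued within
  \<open>E\<close>.\<close>

lemma extend_pieces:
  fixes \<D> :: "(int ^ 'd::finite) set set"
  assumes card: "CARD('d) > 1" and q: "q = 2 * CARD('d) * (4 * CARD('d) + 3)"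
    and toast: "toast q \<D>" and nested: "nested_or_disjoint \<D>" and E: "E \<in> \<D>"
    and ext: "\<And>D. D \<in> \<D> \<Longrightarrow> D \<subset> E \<Longrightarrow> extendable D (R D)"
    and le: "\<And>D D'. D \<in> \<D> \<Longrightarrow> D' \<in> \<D> \<Longrightarrow> D \<subset> D' \<Longrightarrow> D' \<subset> E \<Longrightarrow> R D \<subseteq>\<^sub>m R D'"
  shows "\<exists>m. extendable E m \<and> map_union {D \<in> \<D>. D \<subset> E} R \<subseteq>\<^sub>m m"
proof -
  define J where "J = {D \<in> \<D>. D \<subset> E}"
  define M where "M = {D \<in> J. \<forall>D'\<in>J. D \<subseteq> D' \<longrightarrow> D = D'}"
  \<comment> \<open>Two layers for each of the directions, as \<open>change_phase\<close> needs when
    all of them may have to be flipped.\<close>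
  define r where "r = 2 * CARD('d)"
  have "finite E" using toast E by (auto simp: toast_def)
  then have "finite J" by (auto simp: J_def intro: finite_subset[of _ "Pow E"])
  then have max: "\<exists>D'\<in>M. D \<subseteq> D'" if "D \<in> J" for D
    using finite_has_maximal2[of J D] that by (auto simp: M_def)
  have MJ: "M \<subseteq> J" by (auto simp: M_def)
  have "\<forall>D\<in>M. \<exists>g. proper_output g \<and> (\<forall>v\<in>D. R D v = Some (g v)) \<and> (\<forall>v. v \<notin> thicken r D \<longrightarrow> g v = std_coloring 0 v)"
  proof
    fix D assume "D \<in> M"
    then have "extendable D (R D)" using ext by (auto simp: M_def J_def)
    then obtain f p where f: "proper_output f" "\<And>v. v \<notin> D \<Longrightarrow> f v = std_coloring p v"
      and R: "R D = (\<lambda>v. if v \<in> D then Some (f v) else None)"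
      by (auto simp: extendable_def)
    have "f v = std_coloring p v" if "v \<notin> thicken 0 D" for v
      using f(2) that subset_thicken by blast
    then obtain g where "proper_output g" "\<forall>v\<in>thicken 0 D. g v = f v"
      "\<forall>v. v \<notin> thicken r D \<longrightarrow> g v = std_coloring 0 v"
      using change_phase[OF card finite[of UNIV] f(1), of 0 D p 0] by (auto simp: r_def)
    then show "\<exists>g. proper_output g \<and> (\<forall>v\<in>D. R D v = Some (g v)) \<and>
        (\<forall>v. v \<notin> thicken r D \<longrightarrow> g v = std_coloring 0 v)"
      using subset_thicken[of D 0] by (intro exI[of _ g]) (auto simp: R)
  qed
  then obtain G where G: "\<And>D. D \<in> M \<Longrightarrow> proper_output (G D)"
    "\<And>D v. D \<in> M \<Longrightarrow> v \<in> D \<Longrightarrow> R D v = Some (G D v)"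
    "\<And>D v. D \<in> M \<Longrightarrow> v \<notin> thicken r D \<Longrightarrow> G D v = std_coloring 0 v"
    by (auto dest!: bchoice)
  have sep: "thicken (Suc r) D \<inter> thicken r D' = {}" if D: "D \<in> M" "D' \<in> M" "D \<noteq> D'" for D D'
  proof (rule toast_thicken_disjoint[OF toast])
    show "D \<in> \<D>" "D' \<in> \<D>" using D by (auto simp: M_def J_def)
    then have "D \<subseteq> D' \<or> D' \<subseteq> D \<or> D \<inter> D' = {}"
      using nested by (simp add: nested_or_disjoint_def)
    then show "D \<inter> D' = {}" using D by (auto simp: M_def)
    show "CARD('d) * (2 * Suc r + 1) + CARD('d) * (2 * r + 1) \<le> q"
      by (simp add: q r_def algebra_simps)
  qed fact
  obtain f where f: "proper_output f"
    "\<And>D v. D \<in> M \<Longrightarrow> v \<in> thicken r D \<Longrightarrow> f v = G D v"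
    "\<And>v. (\<And>D. D \<in> M \<Longrightarrow> v \<notin> thicken r D) \<Longrightarrow> f v = std_coloring 0 v"
    using glue_colorings[of M G r 0, OF G(1) G(3) sep] by blast
  define m where "m = (\<lambda>v. if v \<in> E then Some (f v) else None)"
  have "CARD('d) * (2 * r + 1) \<le> q" by (simp add: q r_def algebra_simps)
  \<comment> \<open>All recoloring stays inside \<open>E\<close>, so the glued coloring is standard
    outside \<open>E\<close> and the invariant is restored.\<close>
  then have "thicken r D \<subseteq> E" if "D \<in> M" for D
    using that E by (intro toast_thicken_subset[OF toast, of D E r]) (auto simp: M_def J_def)
  then have "f v = std_coloring 0 v" if "v \<notin> E" for v using f(3) that by blast
  then have "extendable E m" using f(1) unfolding extendable_def m_def by blast
  moreover have "map_union J R \<subseteq>\<^sub>m m"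
    unfolding map_le_def
  proof
    fix x assume "x \<in> dom (map_union J R)"
    moreover have dom: "dom (R D) = D" if "D \<in> J" for D
      using extendable_dom[OF ext] that by (simp add: J_def)
    ultimately obtain D where "D \<in> J" "x \<in> D" by (auto simp: dom_map_union)
    then obtain D' where D': "D' \<in> M" "x \<in> D'" using max by blast
    have "map_union J R x = R D' x"
      using nested D' MJ dom le by (intro map_union_eq_piece[of \<D>]) (auto simp: J_def)
    also have "\<dots> = Some (f x)"
      using G(2) D' f(2)[OF D'(1)] subset_thicken[of D' r] by auto
    also have "\<dots> = m x" using D' MJ by (auto simp: m_def J_def)
    finally show "map_union J R x = m x" .
  qed
  ultimately show ?thesis unfolding J_def by blast
qed

section \<open>The algorithm\<close>

text \<open>An algorithm must extend every admissible input, also one that never arises from a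
  toast; if no extendable extension exists, the gaps are filled with the constant output 0.\<close>

definition choose_extension ::
  "(int ^ 'd::finite) set \<Rightarrow> (int ^ 'd \<rightharpoonup> ('d \<times> bool \<Rightarrow> nat)) \<Rightarrow> int ^ 'd \<rightharpoonup> ('d \<times> bool \<Rightarrow> nat)" where
  "choose_extension S c =
     (if \<exists>m. extendable S m \<and> c \<subseteq>\<^sub>m m then SOME m. extendable S m \<and> c \<subseteq>\<^sub>m m
      else (\<lambda>v. if v \<in> S then Some (case c v of None \<Rightarrow> \<lambda>_. 0 | Some y \<Rightarrow> y) else None))"

lemma choose_extension_extendable:
  assumes "\<exists>m. extendable S m \<and> c \<subseteq>\<^sub>m m"
  shows "extendable S (choose_extension S c) \<and> c \<subseteq>\<^sub>m choose_extension S c"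
  using someI_ex[OF assms] assms by (simp add: choose_extension_def)

lemma choose_extension:
  fixes c :: "int ^ 'd::finite \<rightharpoonup> ('d \<times> bool \<Rightarrow> nat)"
  assumes "dom c \<subseteq> S" "ran c \<subseteq> edge_outputs (2 * CARD('d))"
  shows "dom (choose_extension S c) = S" "ran (choose_extension S c) \<subseteq> edge_outputs (2 * CARD('d))"
    "c \<subseteq>\<^sub>m choose_extension S c"
proof -
  have "dom (choose_extension S c) = S \<and> ran (choose_extension S c) \<subseteq> edge_outputs (2 * CARD('d)) \<and>
    c \<subseteq>\<^sub>m choose_extension S c"
  proof (cases "\<exists>m. extendable S m \<and> c \<subseteq>\<^sub>m m")
    case True
    note ext = choose_extension_extendable[OF True]
    have "ran m \<subseteq> edge_outputs (2 * CARD('d))" if m: "extendable S m" for m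
    proof -
      obtain f where "proper_output f" "m = (\<lambda>v. if v \<in> S then Some (f v) else None)"
        using m by (auto simp: extendable_def)
      then have "ran m \<subseteq> range f" "range f \<subseteq> edge_outputs (2 * CARD('d))"
        by (auto simp only: ran_def proper_output_def edge_outputs_def split: if_splits)
      then show ?thesis by blast
    qed
    then show ?thesis using ext extendable_dom by blast
  next
    case False
    have "(\<lambda>_. 0) \<in> edge_outputs (2 * CARD('d))" by (auto simp: edge_outputs_def)
    then show ?thesis
      using assms unfolding choose_extension_def if_not_P[OF False]
      by (auto simp: ran_def map_le_def split: option.splits if_splits)
  qed
  then show "dom (choose_extension S c) = S"
    "ran (choose_extension S c) \<subseteq> edge_outputs (2 * CARD('d))" "c \<subseteq>\<^sub>m choose_extension S c" by auto
qed

text \<open>Moving the corner of the piece to the origin makes the choice depend only on the isomorphism type.\<close>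

definition corner :: "(int ^ 'd::finite) set \<Rightarrow> int ^ 'd" where
  "corner S = (\<chi> i. Min ((\<lambda>v. v $ i) ` S))"

definition edge_coloring_alg :: "('d::finite, 'd \<times> bool \<Rightarrow> nat) toast_alg" where
  "edge_coloring_alg S c = (\<lambda>u.
     choose_extension ((\<lambda>v. v - corner S) ` S) (\<lambda>v. c (v + corner S)) (u - corner S))"

section \<open>Translations and dependence on the isomorphism type\<close>

lemma corner_translate:
  assumes "finite S" "S \<noteq> {}"
  shows "corner ((\<lambda>v. v + t) ` S) = corner S + t"
proof -
  have "Min ((\<lambda>v. v $ i + t $ i) ` S) = Min ((\<lambda>v. v $ i) ` S) + t $ i" for i
    by (rule Min_add_commute[OF assms])
  then show ?thesis by (simp add: corner_def vec_eq_iff image_image)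
qed

text \<open>Since labels and orientations are kept, the displacement of a vertex under
  \<open>\<phi>\<close> is the same at both ends of an edge, hence constant on a connected
  set.\<close>

lemma grid_iso_translation:
  assumes iso: "grid_iso \<phi> S T" and conn: "grid_connected S"
  obtains t where "\<And>u. u \<in> S \<Longrightarrow> \<phi> u = u + t"
proof (cases "S = {}")
  case True
  then show thesis using that by blast
next
  case False
  then obtain x where x: "x \<in> S" by blast
  have diff_eq: "\<phi> v - v = \<phi> u - u" if uv: "u \<in> S" "v \<in> S" "adj u v" for u v
  proof -
    have edge: "\<phi> y = \<phi> x + gen i" if "x \<in> S" "y \<in> S" "y = x + gen i" for x y i
      using iso that(1,2) that(3) unfolding grid_iso_def by metis
    obtain i where "v = u + gen i \<or> u = v + gen i" using uv(3) by (auto simp: adj_def)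
    then show ?thesis
    proof
      assume "v = u + gen i"
      with edge[OF uv(1,2) this] show ?thesis by simp
    next
      assume "u = v + gen i"
      with edge[OF uv(2,1) this] show ?thesis by simp
    qed
  qed
  have "\<phi> y - y = \<phi> x - x" if "y \<in> S" for y
  proof -
    have "(\<lambda>u v. u \<in> S \<and> v \<in> S \<and> adj u v)\<^sup>*\<^sup>* x y"
      using conn x that by (auto simp: grid_connected_def)
    then show ?thesis
    proof induction
      case (step y z)
      then show ?case using diff_eq[of y z] by simp
    qed simp
  qed
  then have "\<phi> y = y + (\<phi> x - x)" if "y \<in> S" for y
    using that by (simp add: diff_eq_eq add.commute)
  then show thesis by (rule that)
qed

lemma map_le_translate:
  fixes t :: "'a::group_add"
  assumes "(\<lambda>v. c (v + t)) \<subseteq>\<^sub>m m"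
  shows "c \<subseteq>\<^sub>m (\<lambda>u. m (u - t))"
  unfolding map_le_def
proof
  fix x assume "x \<in> dom c"
  then have "x - t \<in> dom (\<lambda>v. c (v + t))" by (simp add: dom_def)
  from bspec[OF assms[unfolded map_le_def] this] show "c x = m (x - t)" by simp
qed

text \<open>An extendable extension can be moved to the copy of \<open>S\<close> at the origin, and
  the chosen one moved back.\<close>

lemma edge_coloring_alg_extendable:
  assumes "\<exists>m. extendable S m \<and> c \<subseteq>\<^sub>m m"
  shows "extendable S (edge_coloring_alg S c) \<and> c \<subseteq>\<^sub>m edge_coloring_alg S c"
proof -
  let ?t = "corner S" and ?S = "(\<lambda>v. v - corner S) ` S" and ?c = "\<lambda>v. c (v + corner S)"
  obtain m where m: "extendable S m" "c \<subseteq>\<^sub>m m" using assms by blast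
  have "extendable ?S (\<lambda>v. m (v + ?t))" using extendable_translate[OF m(1), of "- ?t"] by simp
  moreover have "?c \<subseteq>\<^sub>m (\<lambda>v. m (v + ?t))" using m(2) by (simp add: map_le_def dom_def)
  ultimately have "\<exists>m. extendable ?S m \<and> ?c \<subseteq>\<^sub>m m" by (intro exI conjI)
  from choose_extension_extendable[OF this]
  have ch: "extendable ?S (choose_extension ?S ?c)" "?c \<subseteq>\<^sub>m choose_extension ?S ?c" by auto
  have "(\<lambda>v. v + ?t) ` ?S = S" by (simp add: image_image)
  then have "extendable S (edge_coloring_alg S c)"
    using extendable_translate[OF ch(1), of ?t] by (simp only: edge_coloring_alg_def)
  moreover have "c \<subseteq>\<^sub>m edge_coloring_alg S c"
    unfolding edge_coloring_alg_def using ch(2) by (rule map_le_translate)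
  ultimately show ?thesis by simp
qed

lemma spontaneous_edge_coloring_alg:
  "spontaneous_toast_alg (edge_outputs (2 * CARD('d)))
     (edge_coloring_alg :: ('d::finite, 'd \<times> bool \<Rightarrow> nat) toast_alg)"
  unfolding spontaneous_toast_alg_def
proof (intro conjI allI impI ballI; (elim conjE)?)
  fix S and c :: "int ^ 'd \<rightharpoonup> ('d \<times> bool \<Rightarrow> nat)"
  assume inp: "toast_input (edge_outputs (2 * CARD('d))) S c"
  let ?t = "corner S" and ?S = "(\<lambda>v. v - corner S) ` S" and ?c = "\<lambda>v. c (v + corner S)"
  have mem: "u - ?t \<in> ?S \<longleftrightarrow> u \<in> S" for u by auto
  have "dom ?c \<subseteq> ?S"
  proof
    fix v assume "v \<in> dom ?c"
    then have "v + ?t \<in> S" using inp by (auto simp: toast_input_def)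
    then show "v \<in> ?S" by (force simp: image_iff)
  qed
  moreover have "ran ?c \<subseteq> edge_outputs (2 * CARD('d))"
    using inp by (auto simp: toast_input_def ran_def)
  ultimately have ch: "dom (choose_extension ?S ?c) = ?S"
    "ran (choose_extension ?S ?c) \<subseteq> edge_outputs (2 * CARD('d))" "?c \<subseteq>\<^sub>m choose_extension ?S ?c"
    by (rule choose_extension)+
  have "u \<in> dom (edge_coloring_alg S c) \<longleftrightarrow> u - ?t \<in> dom (choose_extension ?S ?c)" for u
    by (simp add: edge_coloring_alg_def dom_def)
  then show "dom (edge_coloring_alg S c) = S" using ch(1) mem by blast
  show "ran (edge_coloring_alg S c) \<subseteq> edge_outputs (2 * CARD('d))"
    using ch(2) by (auto simp: edge_coloring_alg_def ran_def)
  show "c \<subseteq>\<^sub>m edge_coloring_alg S c"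
    unfolding edge_coloring_alg_def using ch(3) by (rule map_le_translate)
next
  fix S S' \<phi> u and c c' :: "int ^ 'd \<rightharpoonup> ('d \<times> bool \<Rightarrow> nat)"
  assume inp: "toast_input (edge_outputs (2 * CARD('d))) S c"
    "toast_input (edge_outputs (2 * CARD('d))) S' c'"
    and iso: "grid_iso \<phi> S S'" and c: "\<forall>u\<in>S. c' (\<phi> u) = c u" and u: "u \<in> S"
  obtain t where t: "\<And>u. u \<in> S \<Longrightarrow> \<phi> u = u + t"
    using grid_iso_translation[OF iso] inp(1) unfolding toast_input_def by blast
  have "S' = \<phi> ` S" using iso by (auto simp: grid_iso_def bij_betw_def)
  then have S': "S' = (\<lambda>v. v + t) ` S" using t by auto
  have corner: "corner S' = corner S + t"
    unfolding S' using inp(1) u by (intro corner_translate) (auto simp: toast_input_def)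
  \<comment> \<open>The choice depends on the whole partial map, so equality is required off
    \<open>S\<close> too, where both maps are undefined.\<close>
  have "c' (v + t) = c v" for v
  proof (cases "v \<in> S")
    case True
    then show ?thesis using c t by auto
  next
    case False
    then have "v \<notin> dom c" "v + t \<notin> dom c'" using inp S' by (auto simp: toast_input_def)
    then show ?thesis by (simp add: domIff)
  qed
  then have "c' (v + corner S') = c (v + corner S)" for v
    unfolding corner by (simp add: add.assoc[symmetric])
  moreover have "(\<lambda>v. v - corner S') ` S' = (\<lambda>v. v - corner S) ` S"
    unfolding corner unfolding S' by (simp add: image_image)
  moreover have "\<phi> u - corner S' = u - corner S" using t[OF u] corner by simp
  ultimately show "edge_coloring_alg S' c' (\<phi> u) = edge_coloring_alg S c u"
    unfolding edge_coloring_alg_def by simp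
qed

text \<open>The two claims are proved in one induction on size, because coloring \<open>E\<close>
  requires the maps of its subpieces to be compatible as well as extendable.\<close>

lemma run_piece_extendable:
  fixes \<D> :: "(int ^ 'd::finite) set set"
  assumes card: "CARD('d) > 1" and q: "q = 2 * CARD('d) * (4 * CARD('d) + 3)"
    and toast: "toast q \<D>" and nested: "nested_or_disjoint \<D>" and "E \<in> \<D>"
  shows "extendable E (run_piece edge_coloring_alg \<D> E) \<and>
    (\<forall>D\<in>\<D>. D \<subset> E \<longrightarrow> run_piece edge_coloring_alg \<D> D \<subseteq>\<^sub>m run_piece edge_coloring_alg \<D> E)"
  using \<open>E \<in> \<D>\<close>
proof (induction "card E" arbitrary: E rule: less_induct)
  case less
  let ?R = "run_piece edge_coloring_alg \<D>" and ?J = "{D \<in> \<D>. D \<subset> E}"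
  let ?c = "map_union ?J ?R"
  have fin: "finite E" using toast less.prems by (auto simp: toast_def)
  have IH: "extendable D (?R D)" "\<And>D'. D' \<in> \<D> \<Longrightarrow> D' \<subset> D \<Longrightarrow> ?R D' \<subseteq>\<^sub>m ?R D"
    if "D \<in> \<D>" "D \<subset> E" for D
    using less.hyps[OF psubset_card_mono[OF fin that(2)] that(1)] by auto
  have R: "?R E = edge_coloring_alg E ?c"
    using fin by (subst run_piece.simps) simp
  have "\<exists>m. extendable E m \<and> ?c \<subseteq>\<^sub>m m"
    using IH by (intro extend_pieces[OF card q toast nested less.prems]) auto
  then have ext: "extendable E (?R E)" "?c \<subseteq>\<^sub>m ?R E"
    unfolding R using edge_coloring_alg_extendable by auto
  have "?R D \<subseteq>\<^sub>m ?R E" if D: "D \<in> \<D>" "D \<subset> E" for D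
  proof -
    have dom: "dom (?R D') = D'" if "D' \<in> ?J" for D'
      using IH(1) that extendable_dom by blast
    have "?R D \<subseteq>\<^sub>m ?c"
      unfolding map_le_def
    proof
      fix x assume "x \<in> dom (?R D)"
      then have "x \<in> D" using dom D by blast
      then have "?c x = ?R D x"
        using D IH dom by (intro map_union_eq_piece[OF nested]) auto
      then show "?R D x = ?c x" by simp
    qed
    then show ?thesis using ext(2) by (rule map_le_trans)
  qed
  then show ?case using ext(1) by blast
qed

section \<open>The edge coloring problem\<close>

text \<open>The point is closure under isomorphism: \<open>\<phi>\<close> commutes with the steps
  from the root along each generator, so it carries the ball and all the constraints at
  \<open>r\<close> to those at \<open>\<phi> r\<close>.\<close>

lemma is_lcl_proper_edge_coloring:
  "is_lcl (proper_edge_coloring_lcl k :: ('d::finite, 'd \<times> bool \<Rightarrow> nat) lcl)"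
proof -
  let ?P = "proper_edge_coloring_lcl k :: ('d, 'd \<times> bool \<Rightarrow> nat) lcl"
  have allowed: "(r, l) \<in> allowed ?P \<longleftrightarrow> dom l = hop_ball r 1 \<and> ran l \<subseteq> edge_outputs k \<and>
      inj (the (l r)) \<and> (\<forall>i. the (l r) (i, True) = the (l (r + gen i)) (i, False) \<and>
        the (l r) (i, False) = the (l (r - gen i)) (i, True))" for r l
    unfolding proper_edge_coloring_lcl_def lcl.simps mem_Collect_eq prod.case ..
  have fin: "finite (edge_outputs k :: ('d \<times> bool \<Rightarrow> nat) set)"
    using finite_set_of_finite_funs[of "UNIV :: ('d \<times> bool) set" "{..<k}" 0]
    by (simp add: edge_outputs_def image_subset_iff)
  have closed: "(\<phi> r, l') \<in> allowed ?P"
    if rl: "(r, l) \<in> allowed ?P" and iso: "grid_iso \<phi> (dom l) (dom l')"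
      and l': "\<And>u. u \<in> dom l \<Longrightarrow> l' (\<phi> u) = l u" for r l \<phi> l'
  proof -
    from rl have dom: "dom l = hop_ball r 1" and ran: "ran l \<subseteq> edge_outputs k"
      and inj: "inj (the (l r))"
      and edge: "\<And>i. the (l r) (i, True) = the (l (r + gen i)) (i, False)"
        "\<And>i. the (l r) (i, False) = the (l (r - gen i)) (i, True)"
      unfolding allowed by blast+
    note nb = neighbors_in_hop_ball[of r, folded dom]
    have \<phi>: "\<phi> (r + gen i) = \<phi> r + gen i" "\<phi> (r - gen i) = \<phi> r - gen i" for i
    proof -
      have *: "\<phi> v = \<phi> u + gen i" if "u \<in> dom l" "v \<in> dom l" "v = u + gen i" for u v
        using iso that(1,2) that(3) unfolding grid_iso_def by metis
      show "\<phi> (r + gen i) = \<phi> r + gen i" by (rule *[OF nb(1,2) refl])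
      have "\<phi> r = \<phi> (r - gen i) + gen i" by (rule *[OF nb(3,1)]) simp
      then show "\<phi> (r - gen i) = \<phi> r - gen i" by simp
    qed
    have img: "dom l' = \<phi> ` dom l" using iso by (auto simp: grid_iso_def bij_betw_def)
    have "dom l' = hop_ball (\<phi> r) 1"
      unfolding img dom hop_ball_1 by (simp add: image_Un image_image \<phi>)
    moreover have "ran l' \<subseteq> edge_outputs k"
    proof
      fix y assume "y \<in> ran l'"
      then obtain x where "l' x = Some y" by (auto simp: ran_def)
      moreover from this obtain u where "u \<in> dom l" "x = \<phi> u" using img by blast
      ultimately have "l u = Some y" using l' by simp
      then show "y \<in> edge_outputs k" using ran by (auto simp: ran_def)
    qed
    moreover have "l' (\<phi> r) = l r" "l' (\<phi> r + gen i) = l (r + gen i)"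
      "l' (\<phi> r - gen i) = l (r - gen i)" for i
      using l'[OF nb(1)] l'[OF nb(2)[of i]] l'[OF nb(3)[of i]] by (simp_all add: \<phi>)
    ultimately show ?thesis
      unfolding allowed using inj edge by (simp only: simp_thms)
  qed
  show ?thesis
    unfolding is_lcl_def
  proof (intro conjI)
    show "finite (outputs ?P)" using fin by (simp add: proper_edge_coloring_lcl_def)
    show "\<forall>(r, l) \<in> allowed ?P. dom l = hop_ball r (radius ?P) \<and> ran l \<subseteq> outputs ?P"
      by (auto simp: proper_edge_coloring_lcl_def)
    show "\<forall>(r, l) \<in> allowed ?P. \<forall>\<phi> l'. grid_iso \<phi> (dom l) (dom l') \<and>
        (\<forall>u \<in> dom l. l' (\<phi> u) = l u) \<longrightarrow> (\<phi> r, l') \<in> allowed ?P"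
      using closed by blast
  qed
qed

section \<open>From colorings of pieces to a coloring of the grid\<close>

lemma is_coloring_proper_output:
  fixes f :: "int ^ 'd::finite \<Rightarrow> 'd \<times> bool \<Rightarrow> nat"
  assumes "proper_output f"
  shows "is_coloring (proper_edge_coloring_lcl (2 * CARD('d))) (\<lambda>v. Some (f v))"
proof -
  let ?P = "proper_edge_coloring_lcl (2 * CARD('d)) :: ('d, 'd \<times> bool \<Rightarrow> nat) lcl"
  have f: "range (f v) \<subseteq> {..<2 * CARD('d)}" "inj (f v)" "f v (i, True) = f (v + gen i) (i, False)" for v i
    using assms by (auto simp: proper_output_def)
  have f': "f v (i, False) = f (v - gen i) (i, True)" for v i
    using f(3)[of "v - gen i" i] by simp
  have ran: "ran ((\<lambda>v. Some (f v)) |` X) \<subseteq> edge_outputs (2 * CARD('d))" for X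
    using f(1) by (auto simp: ran_def restrict_map_def edge_outputs_def split: if_splits)
  have "(v, (\<lambda>v. Some (f v)) |` hop_ball v 1) \<in> allowed ?P" for v
    unfolding proper_edge_coloring_lcl_def lcl.simps mem_Collect_eq prod.case
    restrict_in[OF neighbors_in_hop_ball(1)] restrict_in[OF neighbors_in_hop_ball(2)]
    restrict_in[OF neighbors_in_hop_ball(3)] option.sel
    using ran f(2) f(3)[of v] f'[of v] by (simp add: dom_def restrict_map_def)
  moreover have "ran (\<lambda>v. Some (f v)) \<subseteq> edge_outputs (2 * CARD('d))"
    using f(1) by (auto simp: ran_def edge_outputs_def)
  ultimately show ?thesis
    unfolding is_coloring_def by (simp add: proper_edge_coloring_lcl_def dom_def)
qed

theorem theorem5p4:
  assumes "CARD('d::finite) > 1"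
  shows "in_TOAST (proper_edge_coloring_lcl (2 * CARD('d)) :: ('d, 'd \<times> bool \<Rightarrow> nat) lcl)"
proof -
  let ?P = "proper_edge_coloring_lcl (2 * CARD('d)) :: ('d, 'd \<times> bool \<Rightarrow> nat) lcl"
  let ?A = "edge_coloring_alg :: ('d, 'd \<times> bool \<Rightarrow> nat) toast_alg"
  \<comment> \<open>With \<open>r = 2 * CARD('d)\<close>, this is twice the length bound of
    \<open>thicken_walk\<close> for \<open>thicken (Suc r)\<close>, which suffices to keep the
    thickened pieces apart.\<close>
  define q where "q = 2 * CARD('d) * (4 * CARD('d) + 3)"
  have "is_coloring ?P (run_toast ?A \<D>)" if toast: "toast q \<D>" and nested: "nested_or_disjoint \<D>" for \<D>
  proof -
    let ?R = "run_piece ?A \<D>" and ?f = "run_toast ?A \<D>"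
    have R: "extendable D (?R D)" "\<And>D'. D' \<in> \<D> \<Longrightarrow> D' \<subset> D \<Longrightarrow> ?R D' \<subseteq>\<^sub>m ?R D" if "D \<in> \<D>" for D
      using run_piece_extendable[OF assms q_def toast nested that] by auto
    have f: "?f x = ?R D x" if "D \<in> \<D>" "x \<in> D" for x D
      unfolding run_toast_def
      by (rule map_union_eq_piece[OF nested subset_refl extendable_dom[OF R(1)] R(2)]) (use that in auto)
    \<comment> \<open>Any two vertices share a piece, so each condition of properness, which
      concerns one vertex or one edge, can be read off from the coloring behind that piece.\<close>
    have pair: "\<exists>h. proper_output h \<and> ?f x = Some (h x) \<and> ?f y = Some (h y)" for x y
    proof -
      obtain D where D: "D \<in> \<D>" "x \<in> D" "y \<in> D" using toast unfolding toast_def by blast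
      obtain h where "proper_output h" "?R D = (\<lambda>v. if v \<in> D then Some (h v) else None)"
        using R(1)[OF D(1)] unfolding extendable_def by blast
      then show ?thesis using f D by (intro exI[of _ h]) simp
    qed
    define g where "g v = the (?f v)" for v
    have fg: "?f v = Some (g v)" for v using pair[of v v] by (auto simp: g_def)
    have g: "\<exists>h. proper_output h \<and> g x = h x \<and> g y = h y" for x y
      using pair[of x y] by (auto simp: g_def)
    have "range (g v) \<subseteq> {..<2 * CARD('d)}" "inj (g v)" for v
      using g[of v v] unfolding proper_output_def by (metis, metis)
    moreover have "g v (i, True) = g (v + gen i) (i, False)" for v i
      using g[of v "v + gen i"] unfolding proper_output_def by metis
    ultimately have "proper_output g" by (simp add: proper_output_def)
    then have "is_coloring ?P (\<lambda>v. Some (g v))" by (rule is_coloring_proper_output)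
    moreover have "?f = (\<lambda>v. Some (g v))" using fg by blast
    ultimately show ?thesis by simp
  qed
  moreover have "outputs ?P = edge_outputs (2 * CARD('d))" by (simp add: proper_edge_coloring_lcl_def)
  moreover have "q > 0" by (simp add: q_def)
  ultimately show ?thesis
    unfolding in_TOAST_def using is_lcl_proper_edge_coloring spontaneous_edge_coloring_alg by metis
qed

end
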